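(* For subsets of $\mathbb R$: (i) For every $s\in\mathbb S$ and each $\alpha$ with $0\leq\alpha<1$, $\mathsf{HD}(\alpha)\neq\mathcal D_{\mathbb R}(\overline s)$. (ii) For every $s\in\mathbb S$, $\mathsf{HD}(1)\neq\mathcal D_{\mathbb R}(\overline s)$ if and only if $s\in\ell^1$ (i.e. $\sum_{n\geq1}s_n<\infty$).
   Context: $\mathbb S$ is the set of all strictly decreasing sequences $s=(s_n)_{n\geq1}$ of positive reals converging to $0$. For $s\in\mathbb S$ and $k\geq1$ let $s^{\times k}=(s_{kn})_{n\geq1}$, and let $\overline s=\{s^{\times k}:k\geq1\}$. For $S\subseteq\mathbb S$, a set $E\subseteq\mathbb R$ is $S$-dominated if for each $t\in S$ there is a sequence $(E_n)_{n\geq1}$ of subsets of $\mathbb R$ that covers $E$ and satisfies $\operatorname{diam}E_n<t_n$ for all $n$; $\mathcal D_{\mathbb R}(S)$ is the family of all $S$-dominated subsets of $\mathbb R$. $\mathsf{HD}(\alpha)=\{E\subseteq\mathbb R:\dim_{\mathsf H}E\leq\alpha\}$, where $\dim_{\mathsf H}$ denotes Hausdorff dimension. *)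

theory Defs
  imports "HOL-Analysis.Analysis"
begin

text \<open>Sequences \<open>(s\<^sub>n)\<close> with \<open>n \<ge> 1\<close> are functions on \<^typ>\<open>nat\<close> whose value at \<open>0\<close> is
  arbitrary; no definition below depends on that value.\<close>

definition SS :: "(nat \<Rightarrow> real) set" where
  "SS = {s. (\<forall>n\<ge>1. s n > 0) \<and> strict_antimono_on {1..} s \<and> s \<longlonglongrightarrow> 0}"

definition dilate :: "nat \<Rightarrow> (nat \<Rightarrow> real) \<Rightarrow> nat \<Rightarrow> real" where
  "dilate k s = (\<lambda>n. s (k * n))"

definition dilations :: "(nat \<Rightarrow> real) \<Rightarrow> (nat \<Rightarrow> real) set" where
  "dilations s = {dilate k s | k. k \<ge> 1}"

text \<open>\<^const>\<open>diameter\<close> is real-valued and is meaningless on unbounded sets (whose diameter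
  should be infinite), hence the explicit boundedness conditions here and below.\<close>

definition dominated :: "(nat \<Rightarrow> real) set \<Rightarrow> real set \<Rightarrow> bool" where
  "dominated S E \<longleftrightarrow>
    (\<forall>t\<in>S. \<exists>F :: nat \<Rightarrow> real set.
       E \<subseteq> (\<Union>n\<in>{1..}. F n) \<and> (\<forall>n\<ge>1. bounded (F n) \<and> diameter (F n) < t n))"

definition dominated_sets :: "(nat \<Rightarrow> real) set \<Rightarrow> real set set" where
  "dominated_sets S = {E. dominated S E}"

text \<open>The \<open>a\<close>-th power of the diameter, with the usual conventions that the empty set
  contributes \<open>0\<close> and that \<open>0\<^sup>0 = 1\<close> (whereas \<open>0 powr 0 = 0\<close>), so that the
  \<open>0\<close>-dimensional Hausdorff measure is the counting measure.\<close>

definition diam_power :: "real \<Rightarrow> 'a::metric_space set \<Rightarrow> ennreal" where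
  "diam_power a U =
    (if U = {} then 0 else if a = 0 then 1 else ennreal (diameter U powr a))"

definition hausdorff_premeasure :: "real \<Rightarrow> real \<Rightarrow> 'a::metric_space set \<Rightarrow> ennreal" where
  "hausdorff_premeasure a \<delta> E =
    (INF F\<in>{F :: nat \<Rightarrow> 'a set. E \<subseteq> (\<Union>n. F n) \<and> (\<forall>n. bounded (F n) \<and> diameter (F n) \<le> \<delta>)}.
       \<Sum>n. diam_power a (F n))"

definition hausdorff_measure :: "real \<Rightarrow> 'a::metric_space set \<Rightarrow> ennreal" where
  "hausdorff_measure a E = (SUP \<delta>\<in>{0<..}. hausdorff_premeasure a \<delta> E)"

text \<open>The infimum is taken in \<^typ>\<open>ereal\<close>, so it is \<open>\<infinity>\<close> if no exponent qualifies, and the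
  empty set has dimension \<open>0\<close>.\<close>

definition hausdorff_dim :: "'a::metric_space set \<Rightarrow> ereal" where
  "hausdorff_dim E = (INF a\<in>{a. 0 \<le> a \<and> hausdorff_measure a E = 0}. ereal a)"

definition HD :: "real \<Rightarrow> real set set" where
  "HD \<alpha> = {E. hausdorff_dim E \<le> ereal \<alpha>}"

end

theory Submission
  imports Defs "HOL-Real_Asymp.Real_Asymp"
begin

text \<open>A single family of sets carries the first claim. For nonnegative weights \<open>a\<close> put
  \<open>g(u) = (\<Sum>i. a i * \<lfloor>2 ^ i * u\<rfloor>)\<close>, a strictly increasing pure jump function when all weights are
  positive. Points at distance at least \<open>2 ^ - i\<close> have images at distance at least \<open>a i\<close>
  (\<open>staircase_separates\<close>), while a dyadic interval of length \<open>2 ^ - n\<close> has an image of diameter at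
  most \<open>\<Sum>i. a (i + n) * 2 ^ i\<close> (\<open>staircase_close\<close>), which is \<open>O(q ^ n)\<close> when \<open>a i = O(q ^ i)\<close>
  with \<open>q < 1 / 2\<close>. So the image of \<open>[0, L)\<close> has cheap covers by construction. It has no covers that
  are much cheaper: pulling a cover back to \<open>[0, L)\<close> turns a bound on the diameters into a bound on
  the spread of each preimage, and these spreads sum to at least \<open>L\<close> by Lebesgue measure
  (\<open>length_le_sum_of_spreads\<close>).

  Fix \<open>0 \<le> \<alpha> < 1\<close>. If for some \<open>\<gamma>\<close> between \<open>\<alpha>\<close> and \<open>1\<close> infinitely many \<open>N\<close> satisfy
  \<open>s N > N powr (- 1 / \<gamma>)\<close>, take \<open>\<eta>\<close> between \<open>\<alpha>\<close> and \<open>\<gamma>\<close> and weights \<open>2 powr (- i / \<eta>)\<close>. The image has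
  dimension at least \<open>\<eta>\<close>. It is dominated, because at a large such \<open>N\<close> the \<open>2 ^ n\<close> pieces of a
  suitable level \<open>n\<close>, about \<open>N / k\<close> in number, are all shorter than \<open>s N\<close>.

  Otherwise \<open>s N \<le> N powr (- 1 / \<gamma>)\<close> eventually, for each \<open>\<gamma>\<close> between \<open>\<alpha>\<close> and \<open>1\<close>. Now let the weights be
  sampled from the sequence itself: \<open>a j = s (M j)\<close> with \<open>M j\<close> about \<open>2 ^ j / (j + 1)\<^sup>2\<close>. The
  polynomial factor does not affect exponents, so the image has dimension at most \<open>\<alpha>\<close>. But a set of
  diameter less than \<open>s n\<close> with \<open>n \<ge> M j\<close> has a preimage of spread at most \<open>2 ^ - j\<close>. Grouping the
  \<open>n\<close>-th sets of a cover by \<open>M j \<le> n < M (j + 1)\<close>, the spreads of their preimages sum to at most \<open>\<Sum>j. M (j + 1) / 2 ^ j < \<infinity>\<close>, too little for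
  a long interval \<open>[0, L)\<close>.

  For the second claim, every set of reals has dimension at most \<open>1\<close>, so the question is
  whether the line itself is dominated. If the series converges, Lebesgue measure forbids this. If it
  diverges, then so does the series of each \<open>(s (k * n))\<close> by monotonicity, and intervals of these
  lengths laid end to end fill the line.\<close>

section \<open>Estimates for Hausdorff measure and dimension\<close>

text \<open>Small sums control the mesh as well: since \<open>\<beta> > 0\<close>, a sum of \<open>\<beta>\<close>-th powers that is at most
  \<open>\<delta> powr \<beta>\<close> forces every single bound \<open>r n\<close> to be at most \<open>\<delta>\<close>.\<close>

lemma hausdorff_measure_eq_0I:
  fixes E :: "'a::metric_space set"
  assumes "\<beta> > 0"
    and cov: "\<And>e. e > 0 \<Longrightarrow> \<exists>F r. E \<subseteq> (\<Union>n. F n) \<and>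
      (\<forall>n::nat. bounded (F n) \<and> diameter (F n) \<le> r n \<and> 0 \<le> r n) \<and>
      summable (\<lambda>n. r n powr \<beta>) \<and> (\<Sum>n. r n powr \<beta>) \<le> e"
  shows "hausdorff_measure \<beta> E = 0"
proof -
  have "hausdorff_premeasure \<beta> \<delta> E = 0" if "\<delta> > 0" for \<delta>
  proof -
    have "hausdorff_premeasure \<beta> \<delta> E \<le> 0 + ennreal \<epsilon>" if "\<epsilon> > 0" for \<epsilon>
    proof -
      define e where "e = min \<epsilon> (\<delta> powr \<beta>)"
      have "e > 0" using \<open>\<epsilon> > 0\<close> \<open>\<delta> > 0\<close> by (simp add: e_def)
      then obtain F r where F: "E \<subseteq> (\<Union>n. F n)" "\<And>n. bounded (F n)" "\<And>n. diameter (F n) \<le> r n"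
          "\<And>n. 0 \<le> r n"
        and r: "summable (\<lambda>n. r n powr \<beta>)" "(\<Sum>n. r n powr \<beta>) \<le> e"
        using cov[of e] by blast
      have "r n \<le> \<delta>" for n
      proof (rule ccontr)
        assume "\<not> r n \<le> \<delta>"
        then have "\<delta> powr \<beta> < r n powr \<beta>"
          using \<open>\<delta> > 0\<close> \<open>\<beta> > 0\<close> by (intro powr_less_mono2) auto
        also have "r n powr \<beta> \<le> (\<Sum>n. r n powr \<beta>)"
          using sum_le_suminf[OF r(1), of "{n}"] by simp
        finally show False using r(2) by (simp add: e_def)
      qed
      then have "diameter (F n) \<le> \<delta>" for n using F(3) order_trans by blast
      then have "hausdorff_premeasure \<beta> \<delta> E \<le> (\<Sum>n. diam_power \<beta> (F n))"
        unfolding hausdorff_premeasure_def using F(1,2) by (intro INF_lower) auto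
      also have "\<dots> \<le> (\<Sum>n. ennreal (r n powr \<beta>))"
      proof (rule suminf_le)
        show "diam_power \<beta> (F n) \<le> ennreal (r n powr \<beta>)" for n
          using \<open>\<beta> > 0\<close> F(2,3)[of n] diameter_ge_0[OF F(2)[of n]]
          by (auto simp: diam_power_def intro!: ennreal_leI powr_mono2)
      qed auto
      also have "\<dots> = ennreal (\<Sum>n. r n powr \<beta>)"
        using r(1) by (intro suminf_ennreal2) auto
      also have "\<dots> \<le> ennreal \<epsilon>" using r(2) by (intro ennreal_leI) (simp add: e_def)
      finally show ?thesis by simp
    qed
    then show ?thesis
      using ennreal_le_epsilon[of 0 "hausdorff_premeasure \<beta> \<delta> E"] by simp
  qed
  then show ?thesis by (simp add: hausdorff_measure_def)
qed

lemma hausdorff_dim_leI: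
  assumes "0 \<le> \<alpha>" "\<alpha> < B"
    and "\<And>\<beta>. \<alpha> < \<beta> \<Longrightarrow> \<beta> < B \<Longrightarrow> hausdorff_measure \<beta> E = 0"
  shows "hausdorff_dim E \<le> ereal \<alpha>"
proof (rule ccontr)
  assume "\<not> ?thesis"
  then have "ereal \<alpha> < min (hausdorff_dim E) (ereal B)" using \<open>\<alpha> < B\<close> by simp
  then obtain \<beta> where \<beta>: "\<alpha> < \<beta>" "ereal \<beta> < hausdorff_dim E" "\<beta> < B"
    using ereal_dense2 by fastforce
  have "hausdorff_dim E \<le> ereal \<beta>"
    unfolding hausdorff_dim_def using assms \<beta> by (intro INF_lower) auto
  with \<beta>(2) show False by simp
qed

text \<open>A form of the mass distribution principle. Only diameters at most \<open>1\<close> matter, and for these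
  the \<open>a\<close>-th power dominates the \<open>\<gamma>\<close>-th power for every \<open>a \<le> \<gamma>\<close>; this includes \<open>a = 0\<close>, where
  every nonempty set counts as \<open>1\<close>.\<close>

lemma hausdorff_dim_geI:
  fixes E :: "'a::metric_space set"
  assumes "\<gamma> > 0" "c > 0"
    and mass: "\<And>F :: nat \<Rightarrow> 'a set. E \<subseteq> (\<Union>n. F n) \<Longrightarrow> (\<And>n. bounded (F n)) \<Longrightarrow>
      c \<le> (\<Sum>n. ennreal (diameter (F n) powr \<gamma>))"
  shows "ereal \<gamma> \<le> hausdorff_dim E"
  unfolding hausdorff_dim_def
proof (rule INF_greatest, clarsimp, rule ccontr)
  fix a assume a: "0 \<le> a" "hausdorff_measure a E = 0" "\<not> \<gamma> \<le> a"
  have "c \<le> hausdorff_premeasure a 1 E"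
    unfolding hausdorff_premeasure_def
  proof (rule INF_greatest, clarify)
    fix F :: "nat \<Rightarrow> 'a set"
    assume F: "E \<subseteq> (\<Union>n. F n)" "\<forall>n. bounded (F n) \<and> diameter (F n) \<le> 1"
    have "ennreal (diameter (F n) powr \<gamma>) \<le> diam_power a (F n)" for n
    proof -
      have d: "0 \<le> diameter (F n)" "diameter (F n) \<le> 1"
        using F(2) diameter_ge_0 by auto
      have "diameter (F n) powr \<gamma> \<le> 1"
        using powr_mono2[OF _ d, of \<gamma>] \<open>\<gamma> > 0\<close> by simp
      moreover have "diameter (F n) powr \<gamma> \<le> diameter (F n) powr a"
        using d a by (intro powr_mono') auto
      ultimately show ?thesis by (auto simp: diam_power_def ennreal_leI ennreal_le_1)
    qed
    then have "(\<Sum>n. ennreal (diameter (F n) powr \<gamma>)) \<le> (\<Sum>n. diam_power a (F n))"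
      by (intro suminf_le) auto
    then show "c \<le> (\<Sum>n. diam_power a (F n))"
      using mass[OF F(1)] F(2) by (meson order_trans)
  qed
  also have "\<dots> \<le> hausdorff_measure a E"
    unfolding hausdorff_measure_def by (rule SUP_upper) simp
  finally show False using a(2) \<open>c > 0\<close> by simp
qed

section \<open>Lengths and spreads\<close>

text \<open>Each set lies in the closed interval between its infimum and its supremum, so countable
  subadditivity of Lebesgue measure applies although the sets need not be measurable. The
  sets come in finite blocks indexed by \<open>j\<close>, because the spread bound used below for the sampled
  weights is constant on blocks of consecutive indices.\<close>

lemma length_le_sum_of_spreads:
  fixes L :: real and A :: "nat \<Rightarrow> nat \<Rightarrow> real set"
  assumes cov: "{0..<L} \<subseteq> (\<Union>j. \<Union>n\<in>B j. A j n)" and fin: "\<And>j. finite (B j)"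
    and spread: "\<And>j n u v. n \<in> B j \<Longrightarrow> u \<in> A j n \<Longrightarrow> v \<in> A j n \<Longrightarrow> \<bar>u - v\<bar> \<le> \<rho> j n"
  shows "ennreal L \<le> (\<Sum>j. \<Sum>n\<in>B j. ennreal (\<rho> j n))"
proof -
  define I where "I j n = (if A j n = {} then {} else {Inf (A j n)..Sup (A j n)})" for j n
  have meas: "I j n \<in> sets lborel" for j n by (simp add: I_def)
  have sub: "A j n \<subseteq> I j n" and len: "emeasure lborel (I j n) \<le> ennreal (\<rho> j n)" if n: "n \<in> B j" for j n
  proof -
    have "A j n \<subseteq> I j n \<and> emeasure lborel (I j n) \<le> ennreal (\<rho> j n)"
    proof (cases "A j n = {}")
      case False
      then obtain u where u: "u \<in> A j n" by blast
      have *: "w \<le> v + \<rho> j n" if "v \<in> A j n" "w \<in> A j n" for v w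
        using spread[OF n that] by linarith
      have ba: "bdd_above (A j n)" using *[OF u] by (auto intro!: bdd_aboveI)
      have "u - \<rho> j n \<le> w" if "w \<in> A j n" for w using *[OF that u] by linarith
      then have bb: "bdd_below (A j n)" by (auto intro!: bdd_belowI)
      have "Sup (A j n) - \<rho> j n \<le> Inf (A j n)"
        by (intro cInf_greatest False) (use * in \<open>force simp: algebra_simps intro!: cSup_least[OF False]\<close>)
      moreover have "Inf (A j n) \<le> Sup (A j n)" by (rule cInf_le_cSup[OF False ba bb])
      ultimately show ?thesis using False ba bb
        by (auto simp: I_def intro!: ennreal_leI cSup_upper cInf_lower)
    qed (simp add: I_def)
    then show "A j n \<subseteq> I j n" "emeasure lborel (I j n) \<le> ennreal (\<rho> j n)" by auto
  qed
  have row: "(\<Union>n\<in>B j. I j n) \<in> sets lborel" for j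
    using fin[of j] meas by (intro sets.finite_UN)
  have "ennreal L = emeasure lborel {0..<L}" by (cases "0 \<le> L") (auto simp: ennreal_neg)
  also have "\<dots> \<le> emeasure lborel (\<Union>j. \<Union>n\<in>B j. I j n)"
  proof (rule emeasure_mono)
    show "{0..<L} \<subseteq> (\<Union>j. \<Union>n\<in>B j. I j n)"
      using sub by (intro order_trans[OF cov] UN_mono subset_refl)
    show "(\<Union>j. \<Union>n\<in>B j. I j n) \<in> sets lborel" using row by (intro sets.countable_UN) blast
  qed
  also have "\<dots> \<le> (\<Sum>j. emeasure lborel (\<Union>n\<in>B j. I j n))"
    using row by (intro emeasure_subadditive_countably) blast
  also have "\<dots> \<le> (\<Sum>j. \<Sum>n\<in>B j. emeasure lborel (I j n))"
  proof (intro suminf_le)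
    show "emeasure lborel (\<Union>n\<in>B j. I j n) \<le> (\<Sum>n\<in>B j. emeasure lborel (I j n))" for j
      using fin[of j] meas by (intro emeasure_subadditive_finite) auto
  qed auto
  also have "\<dots> \<le> (\<Sum>j. \<Sum>n\<in>B j. ennreal (\<rho> j n))"
    using len by (intro suminf_le sum_mono summableI)
  finally show ?thesis .
qed

section \<open>Staircase functions\<close>

definition staircase :: "(nat \<Rightarrow> real) \<Rightarrow> real \<Rightarrow> real" where
  "staircase a u = (\<Sum>i. a i * real_of_int \<lfloor>2 ^ i * u\<rfloor>)"

lemma summable_staircase:
  assumes "\<And>i. 0 \<le> a i" "summable (\<lambda>i. a i * 2 ^ i)"
  shows "summable (\<lambda>i. a i * real_of_int \<lfloor>2 ^ i * (u::real)\<rfloor>)"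
proof (rule summable_comparison_test')
  show "summable (\<lambda>i. (\<bar>u\<bar> + 1) * (a i * 2 ^ i))" using assms(2) by (rule summable_mult)
  fix i :: nat
  have "\<bar>real_of_int \<lfloor>2 ^ i * u\<rfloor>\<bar> \<le> \<bar>2 ^ i * u\<bar> + 1" by linarith
  also have "\<bar>2 ^ i * u\<bar> + 1 \<le> 2 ^ i * (\<bar>u\<bar> + 1)" by (simp add: abs_mult algebra_simps)
  finally have "a i * \<bar>real_of_int \<lfloor>2 ^ i * u\<rfloor>\<bar> \<le> a i * (2 ^ i * (\<bar>u\<bar> + 1))"
    using assms(1) by (intro mult_left_mono) auto
  then show "norm (a i * real_of_int \<lfloor>2 ^ i * u\<rfloor>) \<le> (\<bar>u\<bar> + 1) * (a i * 2 ^ i)"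
    using assms(1)[of i] by (simp add: abs_mult algebra_simps)
qed

lemma staircase_diff:
  assumes "\<And>i. 0 \<le> a i" "summable (\<lambda>i. a i * 2 ^ i)"
  shows "summable (\<lambda>i. a i * real_of_int (\<lfloor>2 ^ i * u\<rfloor> - \<lfloor>2 ^ i * v\<rfloor>))"
    and "staircase a u - staircase a v = (\<Sum>i. a i * real_of_int (\<lfloor>2 ^ i * u\<rfloor> - \<lfloor>2 ^ i * v\<rfloor>))"
  using summable_diff[OF summable_staircase[OF assms, of u] summable_staircase[OF assms, of v]]
    suminf_diff[OF summable_staircase[OF assms, of u] summable_staircase[OF assms, of v]]
  by (simp_all add: staircase_def algebra_simps)

text \<open>Every summand is monotone in \<open>u\<close>, and the \<open>i\<close>-th one jumps by at least \<open>a i\<close>.\<close>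

lemma staircase_separates:
  assumes a: "\<And>i. 0 \<le> a i" "summable (\<lambda>i. a i * 2 ^ i)" and uv: "\<bar>u - v\<bar> \<ge> 1 / 2 ^ i"
  shows "a i \<le> \<bar>staircase a u - staircase a v\<bar>"
proof -
  have *: "a i \<le> staircase a u - staircase a v" if "v + 1 / 2 ^ i \<le> u" for u v
  proof -
    have "0 < (1::real) / 2 ^ i" by simp
    then have "v \<le> u" using that by linarith
    then have "\<lfloor>2 ^ j * v\<rfloor> \<le> \<lfloor>2 ^ j * u\<rfloor>" for j by (intro floor_mono) simp
    then have nn: "0 \<le> a j * real_of_int (\<lfloor>2 ^ j * u\<rfloor> - \<lfloor>2 ^ j * v\<rfloor>)" for j
      using a(1) by (intro mult_nonneg_nonneg) simp_all
    have "2 ^ i * v + 1 \<le> 2 ^ i * u" using that by (simp add: field_simps)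
    then have "1 \<le> \<lfloor>2 ^ i * u\<rfloor> - \<lfloor>2 ^ i * v\<rfloor>" by linarith
    then have "a i * 1 \<le> a i * real_of_int (\<lfloor>2 ^ i * u\<rfloor> - \<lfloor>2 ^ i * v\<rfloor>)"
      using a(1) by (intro mult_left_mono) linarith+
    also have "\<dots> \<le> staircase a u - staircase a v"
      using sum_le_suminf[OF staircase_diff(1)[OF a], of "{i}" u v] nn
      by (simp add: staircase_diff(2)[OF a])
    finally show ?thesis by simp
  qed
  show ?thesis using *[of v u] *[of u v] uv by linarith
qed

text \<open>Two points of the same dyadic interval of length \<open>2 ^ - n\<close> agree in all terms with index below \<open>n\<close>,
  and the integer parts in the term with index \<open>i + n\<close> differ by at most \<open>2 ^ i\<close>.\<close>

lemma staircase_close: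
  assumes a: "\<And>i. 0 \<le> a i" "summable (\<lambda>i. a i * 2 ^ i)" and eq: "\<lfloor>2 ^ n * u\<rfloor> = \<lfloor>2 ^ n * v\<rfloor>"
  shows "\<bar>staircase a u - staircase a v\<bar> \<le> (\<Sum>i. a (i + n) * 2 ^ i)"
proof -
  let ?d = "\<lambda>i. a i * real_of_int (\<lfloor>2 ^ i * u\<rfloor> - \<lfloor>2 ^ i * v\<rfloor>)"
  have "\<lfloor>2 ^ i * u\<rfloor> = \<lfloor>2 ^ i * v\<rfloor>" if "i < n" for i
  proof -
    have "\<lfloor>2 ^ i * x\<rfloor> = \<lfloor>2 ^ n * x\<rfloor> div 2 ^ (n - i)" for x :: real
    proof -
      have "(2::real) ^ n = 2 ^ i * 2 ^ (n - i)" using that by (simp flip: power_add)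
      then have *: "2 ^ i * x = (2 ^ n * x) / real_of_int (2 ^ (n - i))" by simp
      show ?thesis
        unfolding * by (rule floor_divide_real_eq_div) simp
    qed
    then show ?thesis using eq by simp
  qed
  then have head: "(\<Sum>i<n. ?d i) = 0" by simp
  have sm: "summable (\<lambda>i. a (i + n) * 2 ^ i)"
  proof -
    have "summable (\<lambda>i. (a (i + n) * 2 ^ (i + n)) * (1 / 2 ^ n))"
      using summable_ignore_initial_segment[OF a(2), of n] by (rule summable_mult2)
    then show ?thesis by (simp add: power_add)
  qed
  have tail: "\<bar>?d (i + n)\<bar> \<le> a (i + n) * 2 ^ i" for i
  proof -
    have "\<bar>2 ^ n * u - 2 ^ n * v\<bar> < 1" using eq by linarith
    then have "2 ^ i * \<bar>2 ^ n * u - 2 ^ n * v\<bar> < 2 ^ i" by simp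
    also have "2 ^ i * \<bar>2 ^ n * u - 2 ^ n * v\<bar> = \<bar>2 ^ i * (2 ^ n * u - 2 ^ n * v)\<bar>" by (simp add: abs_mult)
    finally have "\<bar>2 ^ (i + n) * u - 2 ^ (i + n) * v\<bar> < real_of_int (2 ^ i)"
      by (simp add: power_add algebra_simps)
    then have "\<bar>\<lfloor>2 ^ (i + n) * u\<rfloor> - \<lfloor>2 ^ (i + n) * v\<rfloor>\<bar> \<le> 2 ^ i" by linarith
    then have "\<bar>real_of_int (\<lfloor>2 ^ (i + n) * u\<rfloor> - \<lfloor>2 ^ (i + n) * v\<rfloor>)\<bar> \<le> 2 ^ i"
      by (metis of_int_abs of_int_le_iff of_int_numeral of_int_power)
    then show ?thesis using a(1)[of "i + n"] by (simp only: abs_mult abs_of_nonneg mult_left_mono)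
  qed
  have "staircase a u - staircase a v = (\<Sum>i. ?d (i + n))"
    using suminf_split_initial_segment[OF staircase_diff(1)[OF a], of u v n] head
    by (simp add: staircase_diff(2)[OF a])
  moreover have "\<bar>\<Sum>i. ?d (i + n)\<bar> \<le> (\<Sum>i. \<bar>?d (i + n)\<bar>)"
    using tail by (intro summable_rabs summable_comparison_test'[OF sm]) auto
  moreover have "(\<Sum>i. \<bar>?d (i + n)\<bar>) \<le> (\<Sum>i. a (i + n) * 2 ^ i)"
    using tail by (intro suminf_le sm summable_comparison_test'[OF sm, of 0]) auto
  ultimately show ?thesis by linarith
qed

lemma summable_geometric_bound:
  fixes a :: "nat \<Rightarrow> real"
  assumes "\<And>i. 0 \<le> a i" "\<And>i. a i \<le> C * q ^ i" "0 < q" "q < 1 / 2"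
  shows "summable (\<lambda>i. a (i + n) * 2 ^ i)" "(\<Sum>i. a (i + n) * 2 ^ i) \<le> C / (1 - 2 * q) * q ^ n"
proof -
  have le: "a (i + n) * 2 ^ i \<le> (C * q ^ n) * (2 * q) ^ i" for i
    using mult_right_mono[OF assms(2)[of "i + n"], of "2 ^ i"] by (simp add: power_add power_mult_distrib algebra_simps)
  have g: "(\<lambda>i. (C * q ^ n) * (2 * q) ^ i) sums ((C * q ^ n) * (1 / (1 - 2 * q)))"
    using assms by (intro sums_mult geometric_sums) simp
  show "summable (\<lambda>i. a (i + n) * 2 ^ i)"
    using le assms(1) by (intro summable_comparison_test'[OF sums_summable[OF g], of 0]) simp
  then show "(\<Sum>i. a (i + n) * 2 ^ i) \<le> C / (1 - 2 * q) * q ^ n"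
    using suminf_le[OF le _ sums_summable[OF g]] sums_unique[OF g] by simp
qed

lemma staircase_cover:
  assumes "\<And>i. 0 \<le> a i" "\<And>i. a i \<le> C * q ^ i" "0 < q" "q < 1 / 2"
  shows "\<exists>F. staircase a ` {0..<real L} \<subseteq> (\<Union>m<L * 2 ^ n. F m) \<and>
    (\<forall>m::nat. bounded (F m) \<and> diameter (F m) \<le> C / (1 - 2 * q) * q ^ n)"
proof -
  define F where "F m = staircase a ` {u. \<lfloor>2 ^ n * u\<rfloor> = int m}" for m
  define d where "d = C / (1 - 2 * q) * q ^ n"
  have s: "summable (\<lambda>i. a i * 2 ^ i)"
    using summable_geometric_bound(1)[OF assms, of 0] by simp
  have dist: "\<bar>x - y\<bar> \<le> d" if xy: "x \<in> F m" "y \<in> F m" for x y m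
  proof -
    obtain u v where uv: "x = staircase a u" "y = staircase a v" "\<lfloor>2 ^ n * u\<rfloor> = \<lfloor>2 ^ n * v\<rfloor>"
      using xy unfolding F_def by auto
    show ?thesis
      using staircase_close[OF assms(1) s uv(3)] summable_geometric_bound(2)[OF assms, of n]
      unfolding uv d_def by linarith
  qed
  have "staircase a u \<in> (\<Union>m<L * 2 ^ n. F m)" if "0 \<le> u" "u < real L" for u
  proof -
    have "2 ^ n * u < 2 ^ n * real L" using that by simp
    then have "\<lfloor>2 ^ n * u\<rfloor> < int (L * 2 ^ n)" by (simp add: floor_less_iff mult.commute)
    moreover have "0 \<le> \<lfloor>2 ^ n * u\<rfloor>" using that by simp
    ultimately show ?thesis
      by (intro UN_I[of "nat \<lfloor>2 ^ n * u\<rfloor>"]) (auto simp: F_def nat_less_iff)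
  qed
  moreover have "bounded (F m)" for m
  proof (cases "F m = {}")
    case False
    then obtain x where "x \<in> F m" by blast
    then have "\<forall>y\<in>F m. dist x y \<le> d" using dist by (simp add: dist_real_def)
    then show ?thesis unfolding bounded_def by blast
  qed auto
  moreover have "diameter (F m) \<le> d" for m
  proof (rule diameter_le)
    have "0 \<le> C" using assms(1)[of 0] assms(2)[of 0] by simp
    then show "F m \<noteq> {} \<or> 0 \<le> d" using assms by (simp add: d_def)
  qed (use dist in auto)
  ultimately show ?thesis unfolding d_def by (intro exI[of _ F]) auto
qed

text \<open>The \<open>L * 2 ^ n\<close> pieces of level \<open>n\<close> have diameter \<open>O(q ^ n)\<close>, so their \<open>\<beta>\<close>-th powers sum to
  \<open>O((2 * q powr \<beta>) ^ n)\<close>.\<close>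

lemma staircase_hausdorff_measure_0:
  assumes a: "\<And>i. 0 \<le> a i" "\<And>i. a i \<le> C * q ^ i" "0 < q" "q < 1 / 2"
    and \<beta>: "\<beta> > 0" "q powr \<beta> < 1 / 2"
  shows "hausdorff_measure \<beta> (staircase a ` {0..<real L}) = 0"
proof (rule hausdorff_measure_eq_0I[OF \<beta>(1)])
  fix e :: real assume "e > 0"
  define K where "K = C / (1 - 2 * q)"
  have "0 \<le> C" using a(1)[of 0] a(2)[of 0] by simp
  then have K: "0 \<le> K" using a by (simp add: K_def)
  have "(\<lambda>n. (2 * q powr \<beta>) ^ n) \<longlonglongrightarrow> 0" using \<beta> by (intro LIMSEQ_realpow_zero) auto
  then have "(\<lambda>n. real L * K powr \<beta> * (2 * q powr \<beta>) ^ n) \<longlonglongrightarrow> 0" by (rule tendsto_mult_right_zero)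
  then have "\<forall>\<^sub>F n in sequentially. real L * K powr \<beta> * (2 * q powr \<beta>) ^ n < e"
    using \<open>e > 0\<close> by (rule order_tendstoD(2))
  then obtain n where n: "real L * K powr \<beta> * (2 * q powr \<beta>) ^ n < e"
    using eventually_happens by force
  obtain F where F: "staircase a ` {0..<real L} \<subseteq> (\<Union>m<L * 2 ^ n. F m)"
      "\<And>m::nat. bounded (F m) \<and> diameter (F m) \<le> K * q ^ n"
    using staircase_cover[OF a, of L n] unfolding K_def by blast
  let ?G = "\<lambda>m. if m < L * 2 ^ n then F m else {}"
  \<comment> \<open>Past the last piece the bound is \<open>0\<close>, and \<open>0 powr \<beta> = 0\<close>.\<close>
  let ?r = "\<lambda>m. if m < L * 2 ^ n then K * q ^ n else 0"
  have fin: "(\<lambda>m. ?r m powr \<beta>) sums (\<Sum>m<L * 2 ^ n. ?r m powr \<beta>)"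
    by (intro sums_finite) auto
  have qn: "(q ^ n) powr \<beta> = (q powr \<beta>) ^ n"
    using a(3) by (simp add: powr_powr mult.commute flip: powr_realpow)
  have "(\<Sum>m<L * 2 ^ n. ?r m powr \<beta>) = real (L * 2 ^ n) * (K * q ^ n) powr \<beta>" by simp
  also have "\<dots> = real L * K powr \<beta> * (2 * q powr \<beta>) ^ n"
    using a(3) K by (simp add: powr_mult qn power_mult_distrib)
  finally have "(\<Sum>m. ?r m powr \<beta>) \<le> e" using n unfolding sums_unique[OF fin, symmetric] by linarith
  moreover have "staircase a ` {0..<real L} \<subseteq> (\<Union>m. ?G m)" using F(1) by fastforce
  ultimately show "\<exists>F r. staircase a ` {0..<real L} \<subseteq> (\<Union>n. F n) \<and>
        (\<forall>n::nat. bounded (F n) \<and> diameter (F n) \<le> r n \<and> 0 \<le> r n) \<and>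
        summable (\<lambda>n. r n powr \<beta>) \<and> (\<Sum>n. r n powr \<beta>) \<le> e"
    using F(2) K a(3) sums_summable[OF fin] by (intro exI[of _ ?G] exI[of _ ?r]) auto
qed

lemma two_powr_less_half: "1 < x \<Longrightarrow> 2 powr - x < (1 / 2 :: real)"
  using powr_less_mono[of "- x" "-1" "2::real"] by (simp add: powr_neg_one)

text \<open>The inverse of this staircase is Hoelder continuous with exponent \<open>\<eta>\<close> and constant \<open>2\<close>: the
  weights are the numbers with \<open>a i powr \<eta> = 1 / 2 ^ i\<close>, so separation by \<open>a i\<close> at scale \<open>1 / 2 ^ i\<close>
  bounds \<open>\<bar>u - v\<bar>\<close> by \<open>2 * \<bar>g u - g v\<bar> powr \<eta>\<close>. Hence the \<open>\<eta>\<close>-th powers of the diameters of a cover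
  sum to at least \<open>1 / 2\<close>.\<close>

lemma staircase_dim_ge:
  assumes \<eta>: "0 < \<eta>" "\<eta> < 1"
  shows "ereal \<eta> \<le> hausdorff_dim (staircase (\<lambda>i. (2 powr (- 1 / \<eta>)) ^ i) ` {0..<1})"
proof (rule hausdorff_dim_geI[where c = "ennreal (1 / 2)"])
  define q where "q = (2::real) powr (- 1 / \<eta>)"
  let ?g = "staircase (\<lambda>i. (2 powr (- 1 / \<eta>)) ^ i)"
  have q: "0 < q" "q < 1 / 2"
    using two_powr_less_half[of "1 / \<eta>"] \<eta> by (simp_all add: q_def)
  have q\<eta>: "q powr \<eta> = 1 / 2" using \<eta> by (simp add: q_def powr_powr powr_neg_one)
  have s: "summable (\<lambda>i. q ^ i * 2 ^ i)"
    using summable_geometric_bound(1)[of "\<lambda>i. q ^ i" 1 q 0] q by simp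
  fix F :: "nat \<Rightarrow> real set"
  assume cov: "?g ` {0..<1} \<subseteq> (\<Union>n. F n)" and bd: "\<And>n. bounded (F n)"
  have spread: "\<bar>u - v\<bar> \<le> 2 * diameter (F n) powr \<eta>"
    if uv: "0 \<le> u" "u < 1" "0 \<le> v" "v < 1" "?g u \<in> F n" "?g v \<in> F n" for u v n
  proof (cases "u = v")
    case False
    \<comment> \<open>Among the dyadic scales that are at most \<open>\<bar>u - v\<bar>\<close> the largest one is within a factor of \<open>2\<close>.\<close>
    define i where "i = (LEAST i. 1 / 2 ^ i \<le> \<bar>u - v\<bar>)"
    have "\<exists>i. (1 / 2) ^ i < \<bar>u - v\<bar>" using False by (intro real_arch_pow_inv) auto
    then have "\<exists>i. 1 / 2 ^ i \<le> \<bar>u - v\<bar>" by (auto simp: power_one_over intro: less_imp_le)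
    then have i: "1 / 2 ^ i \<le> \<bar>u - v\<bar>" unfolding i_def by (rule LeastI_ex)
    have "\<bar>u - v\<bar> < 1" using uv by auto
    then obtain j where j: "i = Suc j" using i by (cases i) auto
    then have "\<not> 1 / 2 ^ j \<le> \<bar>u - v\<bar>"
      using not_less_Least[of j "\<lambda>i. 1 / 2 ^ i \<le> \<bar>u - v\<bar>"] by (simp add: i_def)
    then have "\<bar>u - v\<bar> \<le> 2 * (1 / 2) ^ i" by (simp add: j power_one_over)
    also have "(1 / 2) ^ i = (q ^ i) powr \<eta>"
      using q by (simp add: powr_powr mult.commute flip: powr_realpow q\<eta>)
    also have "(q ^ i) powr \<eta> \<le> diameter (F n) powr \<eta>"
    proof (rule powr_mono2)
      have "q ^ i \<le> \<bar>?g u - ?g v\<bar>"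
        using staircase_separates[of "\<lambda>i. q ^ i" i u v] s i q by (simp add: q_def)
      also have "\<dots> \<le> diameter (F n)"
        using diameter_bounded_bound[OF bd uv(5,6)] by (simp add: dist_real_def)
      finally show "q ^ i \<le> diameter (F n)" .
    qed (use \<eta> q in auto)
    finally show ?thesis by simp
  qed simp
  have "ennreal 1 \<le> (\<Sum>j. \<Sum>n\<in>{0::nat}. ennreal (2 * diameter (F j) powr \<eta>))"
  proof (rule length_le_sum_of_spreads[where A = "\<lambda>j n. {u \<in> {0..<1}. ?g u \<in> F j}"])
    show "{0..<1} \<subseteq> (\<Union>j. \<Union>n\<in>{0::nat}. {u \<in> {0..<1}. ?g u \<in> F j})"
    proof
      fix u :: real assume u: "u \<in> {0..<1}"
      then have "?g u \<in> (\<Union>n. F n)" using cov by blast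
      then show "u \<in> (\<Union>j. \<Union>n\<in>{0::nat}. {u \<in> {0..<1}. ?g u \<in> F j})" using u by blast
    qed
  qed (use spread in auto)
  then have "ennreal (1 / 2) * 1 \<le> ennreal (1 / 2) * (\<Sum>j. ennreal (2 * diameter (F j) powr \<eta>))"
    by (intro mult_left_mono) auto
  also have "\<dots> = (\<Sum>j. ennreal (diameter (F j) powr \<eta>))"
    unfolding ennreal_suminf_cmult[symmetric] by (subst ennreal_mult[symmetric]) simp_all
  finally show "ennreal (1 / 2) \<le> (\<Sum>j. ennreal (diameter (F j) powr \<eta>))" by simp
next
  show "0 < ennreal (1 / 2)" by (subst ennreal_less_zero_iff) simp
qed (use \<eta> in simp)

section \<open>Dominated sets and the real line\<close>

lemma SS_pos: "s \<in> SS \<Longrightarrow> 1 \<le> n \<Longrightarrow> 0 < s n"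
  by (simp add: SS_def)

lemma SS_antimono: "s \<in> SS \<Longrightarrow> 1 \<le> m \<Longrightarrow> m \<le> n \<Longrightarrow> s n \<le> s m"
  by (cases "m = n") (auto simp: SS_def monotone_on_def intro: less_imp_le)

lemma self_in_dilations: "s \<in> dilations s"
  unfolding dilations_def dilate_def by (force intro: exI[of _ 1])

lemma dominated_subset: "dominated S E \<Longrightarrow> E' \<subseteq> E \<Longrightarrow> dominated S E'"
  unfolding dominated_def by (meson order_trans)

text \<open>Each block of \<open>m\<close> consecutive terms is at most \<open>m\<close> times the term of the subsequence at its
  left end.\<close>

lemma not_summable_dilate:
  assumes s: "s \<in> SS" and ns: "\<not> summable (\<lambda>n. s (Suc n))" and m: "1 \<le> m"
  shows "\<not> summable (\<lambda>n. s (m * Suc n))"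
proof
  assume sm: "summable (\<lambda>n. s (m * Suc n))"
  have pos: "0 \<le> s (m * Suc n)" for n using SS_pos[OF s] m by (intro less_imp_le) simp
  have "(\<Sum>i<N. norm (s (i + m))) \<le> m * (\<Sum>n. s (m * Suc n))" for N
  proof -
    have "(\<Sum>i<N. norm (s (i + m))) \<le> (\<Sum>i<N * m. s (i + m))"
      using SS_pos[OF s] m by (auto intro!: sum_mono2 simp: less_imp_le abs_of_pos cong: sum.cong)
    also have "\<dots> = (\<Sum>n<N. \<Sum>i=n * m..<n * m + m. s (i + m))"
      by (rule sum.nat_group[symmetric])
    also have "\<dots> \<le> (\<Sum>n<N. \<Sum>i=n * m..<n * m + m. s (m * Suc n))"
      using m by (intro sum_mono SS_antimono[OF s]) (auto simp: mult.commute)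
    also have "\<dots> = m * (\<Sum>n<N. s (m * Suc n))" by (simp add: sum_distrib_left)
    also have "\<dots> \<le> m * (\<Sum>n. s (m * Suc n))"
      using sm pos by (intro mult_left_mono sum_le_suminf) auto
    finally show ?thesis .
  qed
  then have "summable (\<lambda>i. s (i + m))"
    by (intro summable_norm_cancel[OF summableI_nonneg_bounded]) auto
  then have "summable s" by (simp add: summable_iff_shift)
  then show False using ns by (simp add: summable_Suc_iff)
qed

text \<open>The intervals are laid end to end from \<open>0\<close>, those with even index to the right and those with
  odd index to the left. The indices \<open>2 * n + 1\<close> and \<open>2 * n + 2\<close> share the length
  \<open>s (2 * k * (n + 1)) / 2\<close>: half of the smaller of their two bounds, so that the strict
  inequality holds for both.\<close>

lemma real_line_cover_if_not_summable:
  assumes s: "s \<in> SS" and ns: "\<not> summable (\<lambda>n. s (Suc n))" and k: "1 \<le> k"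
  shows "\<exists>F. UNIV \<subseteq> (\<Union>n\<in>{1..}. F n) \<and>
    (\<forall>n\<ge>1. bounded (F n) \<and> diameter (F n :: real set) < s (k * n))"
proof -
  define c where "c n = s (2 * k * Suc n) / 2" for n
  define P where "P n = (\<Sum>i<n. c i)" for n
  define F where "F m = (let n = (m - 1) div 2 in
    if even m then {P n..P (Suc n)} else {- P (Suc n)..- P n})" for m
  have c: "0 < c n" for n using SS_pos[OF s] k by (simp add: c_def)
  have "\<not> summable c"
    using not_summable_dilate[OF s ns, of "2 * k"] k summable_divide_iff[of "\<lambda>n. s (2 * k * Suc n)" 2]
    by (simp add: c_def[abs_def])
  then have unb: "\<exists>n. x < P n" for x
    using summableI_nonneg_bounded[of c x] c unfolding P_def by (meson less_imp_le not_le)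
  have cov: "\<exists>n. P n \<le> x \<and> x \<le> P (Suc n)" if x: "0 \<le> x" for x
  proof -
    define N where "N = (LEAST n. x < P n)"
    have N: "x < P N" unfolding N_def by (rule LeastI_ex) (rule unb)
    then obtain n where n: "N = Suc n" using x by (cases N) (auto simp: P_def)
    then have "\<not> x < P n" using not_less_Least[of n "\<lambda>n. x < P n"] by (simp add: N_def)
    then show ?thesis using N n by (intro exI[of _ n]) simp
  qed
  have "x \<in> (\<Union>n\<in>{1..}. F n)" for x
  proof (cases "0 \<le> x")
    case True
    then obtain n where "P n \<le> x" "x \<le> P (Suc n)" using cov by blast
    then have "x \<in> F (2 * n + 2)" by (simp add: F_def)
    then show ?thesis by (intro UN_I[of "2 * n + 2"]) auto
  next
    case False
    then obtain n where "P n \<le> - x" "- x \<le> P (Suc n)" using cov[of "- x"] by auto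
    then have "x \<in> F (2 * n + 1)" by (simp add: F_def)
    then show ?thesis by (intro UN_I[of "2 * n + 1"]) auto
  qed
  moreover have "bounded (F m) \<and> diameter (F m) < s (k * m)" if m: "1 \<le> m" for m
  proof -
    let ?n = "(m - 1) div 2"
    have "diameter (F m) \<le> c ?n"
      using c[of ?n] by (intro diameter_le) (auto simp: F_def Let_def P_def abs_le_iff split: if_splits)
    also have "c ?n < s (2 * k * Suc ?n)" using c[of ?n] by (simp add: c_def)
    also have "\<dots> \<le> s (k * m)"
    proof (rule SS_antimono[OF s])
      have "m \<le> 2 * Suc ?n" by presburger
      then have "k * m \<le> k * (2 * Suc ?n)" by (rule mult_left_mono) simp
      then show "k * m \<le> 2 * k * Suc ?n" by (simp add: algebra_simps)
    qed (use k m in simp)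
    finally show ?thesis by (simp add: F_def Let_def)
  qed
  ultimately show ?thesis by (intro exI[of _ F]) auto
qed

lemma dominated_UNIV_iff:
  assumes s: "s \<in> SS"
  shows "dominated (dilations s) UNIV \<longleftrightarrow> \<not> summable (\<lambda>n. s (Suc n))"
proof
  assume dom: "dominated (dilations s) UNIV"
  obtain F :: "nat \<Rightarrow> real set" where F: "UNIV \<subseteq> (\<Union>n\<in>{1..}. F n)"
      "\<And>n. 1 \<le> n \<Longrightarrow> bounded (F n) \<and> diameter (F n) < s n"
    using dom self_in_dilations unfolding dominated_def by blast
  show "\<not> summable (\<lambda>n. s (Suc n))"
  proof
    assume sm: "summable (\<lambda>n. s (Suc n))"
    let ?S = "\<Sum>n. s (Suc n)"
    have pos: "0 \<le> s (Suc n)" for n using SS_pos[OF s, of "Suc n"] by simp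
    have "ennreal (?S + 1) \<le> (\<Sum>j. \<Sum>n\<in>{0::nat}. ennreal (s (Suc j)))"
    proof (rule length_le_sum_of_spreads[where A = "\<lambda>j n. F (Suc j)"])
      show "{0..<?S + 1} \<subseteq> (\<Union>j. \<Union>n\<in>{0::nat}. F (Suc j))"
      proof
        fix x :: real
        obtain n where "1 \<le> n" "x \<in> F n" using F(1) by auto
        then show "x \<in> (\<Union>j. \<Union>n\<in>{0::nat}. F (Suc j))" by (cases n) auto
      qed
      show "\<bar>u - v\<bar> \<le> s (Suc j)" if "u \<in> F (Suc j)" "v \<in> F (Suc j)" for j u v
        using diameter_bounded_bound[of "F (Suc j)" u v] F(2)[of "Suc j"] that
        by (simp add: dist_real_def)
    qed auto
    also have "\<dots> = ennreal ?S" using sm pos by (simp add: suminf_ennreal2)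
    finally show False using suminf_nonneg[OF sm pos] by (simp add: ennreal_le_iff)
  qed
next
  assume "\<not> summable (\<lambda>n. s (Suc n))"
  then show "dominated (dilations s) UNIV"
    using real_line_cover_if_not_summable[OF s]
    unfolding dominated_def dilations_def dilate_def by blast
qed

text \<open>The covers come from domination of the line by the dilations of \<open>1 / n\<close>: the harmonic series
  diverges, while for \<open>\<beta> > 1\<close> the \<open>\<beta>\<close>-th powers of \<open>1 / (k * n)\<close> have a finite sum that tends to \<open>0\<close> as \<open>k\<close>
  grows.\<close>

lemma hausdorff_dim_real_le_1: "hausdorff_dim (E :: real set) \<le> ereal 1"
proof (rule hausdorff_dim_leI[of 1 2])
  fix \<beta> :: real assume \<beta>: "1 < \<beta>" "\<beta> < 2"
  let ?t = "\<lambda>n. 1 / real n"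
  have t: "?t \<in> SS"
    using lim_1_over_n by (auto simp: SS_def monotone_on_def frac_less2)
  have nt: "\<not> summable (\<lambda>n. ?t (Suc n))"
    using not_summable_harmonic[where 'a = real] summable_Suc_iff[of ?t] by (simp add: inverse_eq_divide)
  have "summable (\<lambda>n. real (Suc n) powr (- \<beta>))"
    using \<beta> summable_real_powr_iff[of "- \<beta>"] by (subst summable_Suc_iff) simp
  then have sm: "summable (\<lambda>n. (1 / real (Suc n)) powr \<beta>)"
    by (simp add: powr_minus_divide powr_divide)
  define Z where "Z = (\<Sum>n. (1 / real (Suc n)) powr \<beta>)"
  have Z: "0 \<le> Z" unfolding Z_def by (intro suminf_nonneg sm) simp
  show "hausdorff_measure \<beta> E = 0"
  proof (rule hausdorff_measure_eq_0I)
    fix e :: real assume "e > 0"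
    \<comment> \<open>Scaling by \<open>1 / k\<close> multiplies the sum \<open>Z\<close> by \<open>(1 / k) powr \<beta> \<le> 1 / k\<close>.\<close>
    define k where "k = nat \<lceil>Z / e\<rceil> + 1"
    have k: "1 \<le> k" "Z / e \<le> real k" unfolding k_def by linarith+
    obtain F :: "nat \<Rightarrow> real set" where F: "UNIV \<subseteq> (\<Union>n\<in>{1..}. F n)"
        "\<And>n. 1 \<le> n \<Longrightarrow> bounded (F n) \<and> diameter (F n) < 1 / real (k * n)"
      using real_line_cover_if_not_summable[OF t nt k(1)] by blast
    let ?r = "\<lambda>n. 1 / real (k * Suc n)"
    have eq: "?r n powr \<beta> = (1 / real k) powr \<beta> * (1 / real (Suc n)) powr \<beta>" for n
      by (subst powr_mult[symmetric]) (simp_all del: of_nat_Suc mult_Suc_right)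
    have "(1 / real k) powr \<beta> \<le> (1 / real k) powr 1"
      using k \<beta> by (intro powr_mono') auto
    then have "(1 / real k) powr \<beta> * Z \<le> 1 / real k * Z"
      using Z k by (intro mult_right_mono) auto
    also have "\<dots> \<le> e" using k \<open>e > 0\<close> by (simp add: field_simps)
    finally have "(1 / real k) powr \<beta> * Z \<le> e" .
    moreover have "summable (\<lambda>n. ?r n powr \<beta>)" "(\<Sum>n. ?r n powr \<beta>) = (1 / real k) powr \<beta> * Z"
      unfolding eq Z_def using sm by (auto intro!: summable_mult suminf_mult)
    moreover have "E \<subseteq> (\<Union>n. F (Suc n))"
    proof
      fix x assume "x \<in> E"
      obtain n where "1 \<le> n" "x \<in> F n" using F(1) by auto
      then show "x \<in> (\<Union>n. F (Suc n))" by (cases n) auto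
    qed
    moreover have "\<forall>n. bounded (F (Suc n)) \<and> diameter (F (Suc n)) \<le> ?r n \<and> 0 \<le> ?r n"
      using F(2)[of "Suc n" for n] by (auto intro: less_imp_le simp del: of_nat_Suc of_nat_mult mult_Suc_right)
    ultimately show "\<exists>F r. E \<subseteq> (\<Union>n. F n) \<and>
        (\<forall>n::nat. bounded (F n) \<and> diameter (F n) \<le> r n \<and> 0 \<le> r n) \<and>
        summable (\<lambda>n. r n powr \<beta>) \<and> (\<Sum>n. r n powr \<beta>) \<le> e"
      by (intro exI[of _ "\<lambda>n. F (Suc n)"] exI[of _ ?r]) auto
  qed (use \<beta> in simp)
qed auto

section \<open>A dominated set of larger dimension\<close>

text \<open>Domination of a set needs only one good scale for each dilation, whereas Hausdorff
  dimension is governed by all scales. So it is enough that \<open>s\<close> is large at infinitely many indices.\<close>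

lemma dominated_set_of_larger_dim:
  assumes s: "s \<in> SS" and \<alpha>: "0 \<le> \<alpha>" "\<alpha> < \<gamma>" "\<gamma> < 1"
    and freq: "\<exists>\<^sub>F N in sequentially. real N powr (- 1 / \<gamma>) < s N"
  shows "\<exists>E. dominated (dilations s) E \<and> ereal \<alpha> < hausdorff_dim E"
proof -
  define \<eta> where "\<eta> = (\<alpha> + \<gamma>) / 2"
  have \<eta>: "0 < \<eta>" "\<eta> < 1" "\<alpha> < \<eta>" "\<eta> < \<gamma>" using \<alpha> by (auto simp: \<eta>_def)
  define q where "q = (2::real) powr (- 1 / \<eta>)"
  have q: "0 < q" "q < 1 / 2"
    using two_powr_less_half[of "1 / \<eta>"] \<eta> by (simp_all add: q_def)
  define K where "K = 1 / (1 - 2 * q)"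
  let ?E = "staircase (\<lambda>i. q ^ i) ` {0..<real 1}"
  have "dominated (dilations s) ?E"
    unfolding dominated_def
  proof
    fix t assume "t \<in> dilations s"
    then obtain k where k: "1 \<le> k" and t: "t = (\<lambda>n. s (k * n))"
      by (auto simp: dilations_def dilate_def)
    define p where "p = (2::real) powr (- 1 / \<gamma>)"
    have "q < p" unfolding p_def q_def using \<eta> by (intro powr_less_mono) (auto simp: field_simps)
    then have "(\<lambda>n. (q / p) ^ n) \<longlonglongrightarrow> 0" using q by (intro LIMSEQ_realpow_zero) auto
    then have "(\<lambda>n. K * (q / p) ^ n) \<longlonglongrightarrow> 0" by (rule tendsto_mult_right_zero)
    moreover have "0 < (2 * real k) powr (- 1 / \<gamma>)" using k by simp
    ultimately have "\<forall>\<^sub>F n in sequentially. K * (q / p) ^ n < (2 * real k) powr (- 1 / \<gamma>)"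
      by (rule order_tendstoD(2))
    then obtain n0 where n0: "\<And>n. n0 \<le> n \<Longrightarrow> K * (q / p) ^ n < (2 * real k) powr (- 1 / \<gamma>)"
      by (auto simp: eventually_sequentially)
    have "\<exists>N>k * 2 ^ n0. real N powr (- 1 / \<gamma>) < s N"
      using freq by (simp add: frequently_sequentially INFM_nat flip: cofinite_eq_sequentially)
    then obtain N where N: "k * 2 ^ n0 < N" "real N powr (- 1 / \<gamma>) < s N" by blast
    have kpos: "0 < k" using k by simp
    \<comment> \<open>The level is chosen as fine as \<open>N\<close> allows, so that \<open>2 * k * 2 ^ n\<close> exceeds \<open>N\<close>.\<close>
    obtain n where n: "n0 \<le> n" "k * 2 ^ n \<le> N" "N < 2 * k * 2 ^ n"
    proof -
      define m where "m = (LEAST m. N < k * 2 ^ m)"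
      have "N < 2 ^ N" by (rule less_exp)
      also have "2 ^ N \<le> k * 2 ^ N" using kpos by simp
      finally have m: "N < k * 2 ^ m" unfolding m_def by (rule LeastI)
      have "n0 < m"
      proof (rule ccontr)
        assume "\<not> n0 < m"
        then have "k * 2 ^ m \<le> k * 2 ^ n0" by (simp add: power_increasing)
        then show False using m N(1) by linarith
      qed
      then obtain n where mn: "m = Suc n" by (cases m) auto
      then have "\<not> N < k * 2 ^ n" using not_less_Least[of n "\<lambda>m. N < k * 2 ^ m"] by (simp add: m_def)
      then show thesis using that[of n] m \<open>n0 < m\<close> mn by (simp add: mult_ac)
    qed
    have "0 < p ^ n" by (simp add: p_def)
    then have "K * q ^ n < (2 * real k) powr (- 1 / \<gamma>) * p ^ n"
      using n0[OF n(1)] by (simp add: power_divide field_simps)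
    also have "p ^ n = (2 ^ n) powr (- 1 / \<gamma>)"
      by (simp add: p_def powr_powr mult.commute flip: powr_realpow)
    also have "(2 * real k) powr (- 1 / \<gamma>) * (2 ^ n) powr (- 1 / \<gamma>) = (real (2 * k * 2 ^ n)) powr (- 1 / \<gamma>)"
      by (simp add: powr_mult)
    also have "\<dots> \<le> real N powr (- 1 / \<gamma>)"
      using n N \<alpha> by (intro powr_mono2') (auto simp del: of_nat_mult of_nat_power)
    also have "\<dots> < s N" by (rule N(2))
    finally have small: "K * q ^ n < s N" .
    obtain F where F: "?E \<subseteq> (\<Union>m<1 * 2 ^ n. F m)"
        "\<And>m::nat. bounded (F m) \<and> diameter (F m) \<le> K * q ^ n"
      using staircase_cover[of "\<lambda>i. q ^ i" 1 q 1 n] q unfolding K_def by auto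
    \<comment> \<open>A shift by one, since the index \<open>0\<close> does not take part in domination.\<close>
    define G where "G m = (if m \<le> 2 ^ n then F (m - 1) else {})" for m
    have "?E \<subseteq> (\<Union>m\<in>{1..}. G m)"
    proof
      fix x assume "x \<in> ?E"
      then obtain m where "m < 2 ^ n" "x \<in> F m" using F(1) by auto
      then show "x \<in> (\<Union>m\<in>{1..}. G m)" by (intro UN_I[of "Suc m"]) (auto simp: G_def)
    qed
    moreover have "bounded (G m) \<and> diameter (G m) < t m" if m: "1 \<le> m" for m
    proof (cases "m \<le> 2 ^ n")
      case True
      then have "k * m \<le> N" using n(2) mult_le_mono2[of m "2 ^ n" k] by linarith
      then have "s N \<le> t m" using k m SS_antimono[OF s, of "k * m" N] by (simp add: t)
      then show ?thesis using True F(2)[of "m - 1"] small by (simp add: G_def)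
    next
      case False
      then show ?thesis using SS_pos[OF s, of "k * m"] k m by (simp add: G_def t)
    qed
    ultimately show "\<exists>F. ?E \<subseteq> (\<Union>n\<in>{1..}. F n) \<and> (\<forall>n\<ge>1. bounded (F n) \<and> diameter (F n) < t n)"
      by blast
  qed
  moreover have "ereal \<alpha> < hausdorff_dim ?E"
    using staircase_dim_ge[OF \<eta>(1,2)] \<eta>(3) less_le_trans[of "ereal \<alpha>" "ereal \<eta>"]
    by (simp add: q_def)
  ultimately show ?thesis by blast
qed

section \<open>An undominated set of small dimension\<close>

text \<open>The indices must satisfy two competing demands: \<open>\<Sum>j. sample_index (j + 1) / 2 ^ j\<close> has to converge,
  and \<open>sample_index j\<close> has to exceed \<open>2 powr (c * j)\<close> eventually, for every \<open>c < 1\<close>. The square in the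
  denominator achieves both.\<close>

definition sample_index :: "nat \<Rightarrow> nat" where
  "sample_index j = nat \<lceil>2 ^ j / (real j + 1) ^ 2\<rceil>"

lemma sample_index_bounds:
  "2 ^ j / (real j + 1) ^ 2 \<le> real (sample_index j)"
  "real (sample_index j) \<le> 2 ^ j / (real j + 1) ^ 2 + 1"
  "1 \<le> sample_index j"
proof -
  have "0 < 2 ^ j / (real j + 1) ^ 2" by simp
  then show "2 ^ j / (real j + 1) ^ 2 \<le> real (sample_index j)"
    "real (sample_index j) \<le> 2 ^ j / (real j + 1) ^ 2 + 1" "1 \<le> sample_index j"
    unfolding sample_index_def by linarith+
qed

lemma filterlim_sample_index: "filterlim sample_index at_top sequentially"
proof -
  have "filterlim (\<lambda>j. 2 ^ j / (real j + 1) ^ 2) at_top sequentially" by real_asymp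
  then have "filterlim (\<lambda>j. real (sample_index j)) at_top sequentially"
    by (rule filterlim_at_top_mono) (simp add: sample_index_bounds)
  then show ?thesis
    by (simp add: filterlim_sequentially_iff_filterlim_real)
qed

lemma summable_sample_index: "summable (\<lambda>j. real (sample_index (Suc j)) / 2 ^ j)"
proof (rule summable_comparison_test')
  have "summable (\<lambda>j. inverse (real (j + 2) ^ 2))"
    by (rule summable_ignore_initial_segment[OF inverse_power_summable]) simp
  then have "summable (\<lambda>j. 2 * inverse (real (j + 2) ^ 2))" by (rule summable_mult)
  then show "summable (\<lambda>j. 2 * inverse (real (j + 2) ^ 2) + (1 / 2) ^ j)"
    by (rule summable_add) (simp add: summable_geometric)
  fix j :: nat
  have "real (sample_index (Suc j)) / 2 ^ j \<le> (2 ^ Suc j / (real (Suc j) + 1) ^ 2 + 1) / 2 ^ j"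
    by (intro divide_right_mono sample_index_bounds) simp
  also have "\<dots> = 2 * inverse (real (j + 2) ^ 2) + (1 / 2) ^ j"
  proof -
    have "real (Suc j) + 1 = real (j + 2)" by simp
    moreover have "(2 ^ Suc j / x + 1) / 2 ^ j = 2 * inverse x + (1 / 2) ^ j" for x :: real
      by (simp add: add_divide_distrib power_one_over inverse_eq_divide)
    ultimately show ?thesis by simp
  qed
  finally show "norm (real (sample_index (Suc j)) / 2 ^ j) \<le> 2 * inverse (real (j + 2) ^ 2) + (1 / 2) ^ j"
    by simp
qed

text \<open>The loss from \<open>\<delta>\<close> to \<open>\<gamma>\<close> is exponential and absorbs the factor \<open>(j + 1) powr (2 / \<delta>)\<close> that
  the polynomial denominator of the indices contributes.\<close>

lemma geometric_bound_of_samples: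
  assumes s: "s \<in> SS" and \<delta>: "0 < \<delta>" "\<delta> < \<gamma>"
    and ev: "\<forall>\<^sub>F N in sequentially. s N \<le> real N powr (- 1 / \<delta>)"
  shows "\<exists>C. \<forall>j. s (sample_index j) \<le> C * (2 powr (- 1 / \<gamma>)) ^ j"
proof -
  define q where "q = (2::real) powr (- 1 / \<gamma>)"
  have q: "0 < q" by (simp add: q_def)
  \<comment> \<open>The number \<open>d\<close> is the exponential rate gained by passing from \<open>\<delta>\<close> to \<open>\<gamma>\<close>.\<close>
  define d where "d = (1 / \<delta> - 1 / \<gamma>) * ln 2"
  have "0 < d" unfolding d_def using \<delta> by (auto simp: field_simps)
  then have "(\<lambda>j. exp (- d * real j) * (real j + 1) powr (2 / \<delta>)) \<longlonglongrightarrow> 0"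
    by real_asymp
  then have "\<forall>\<^sub>F j in sequentially. exp (- d * real j) * (real j + 1) powr (2 / \<delta>) < 1"
    by (rule order_tendstoD(2)) simp
  moreover have "\<forall>\<^sub>F j in sequentially. s (sample_index j) \<le> real (sample_index j) powr (- 1 / \<delta>)"
    using ev filterlim_sample_index by (rule eventually_compose_filterlim)
  ultimately have "\<forall>\<^sub>F j in sequentially. s (sample_index j) \<le> q ^ j"
  proof eventually_elim
    case (elim j)
    have "s (sample_index j) \<le> (2 ^ j / (real j + 1) ^ 2) powr (- 1 / \<delta>)"
      using elim(2) powr_mono2'[OF _ _ sample_index_bounds(1)[of j], of "- 1 / \<delta>"] \<delta> by simp
    also have "\<dots> = q ^ j * (exp (- d * real j) * (real j + 1) powr (2 / \<delta>))"
    proof -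
      have "ln ((2 ^ j / (real j + 1) ^ 2) powr (- 1 / \<delta>)) =
          (- 1 / \<delta>) * (real j * ln 2 - 2 * ln (real j + 1))"
        by (simp add: ln_powr ln_div ln_realpow)
      also have "\<dots> = ln (q ^ j * (exp (- d * real j) * (real j + 1) powr (2 / \<delta>)))"
        using q by (simp add: ln_mult ln_realpow ln_powr d_def) (simp add: q_def ln_powr algebra_simps diff_divide_distrib)
      finally show ?thesis using q by (subst (asm) ln_inj_iff) auto
    qed
    also have "\<dots> \<le> q ^ j * 1" using elim(1) q by (intro mult_left_mono) auto
    finally show ?case by simp
  qed
  then obtain j0 where j0: "\<And>j. j0 \<le> j \<Longrightarrow> s (sample_index j) \<le> q ^ j"
    by (auto simp: eventually_sequentially)
  have pos: "0 \<le> s (sample_index j) / q ^ j" for j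
    using q SS_pos[OF s sample_index_bounds(3)[of j]] by simp
  define C where "C = 1 + (\<Sum>j<j0. s (sample_index j) / q ^ j)"
  have "s (sample_index j) / q ^ j \<le> C" for j
  proof (cases "j0 \<le> j")
    case True
    then have "s (sample_index j) / q ^ j \<le> 1" using j0 q by simp
    moreover have "1 \<le> C" using pos by (simp add: C_def sum_nonneg)
    ultimately show ?thesis by linarith
  next
    case False
    then have "s (sample_index j) / q ^ j \<le> (\<Sum>j<j0. s (sample_index j) / q ^ j)"
      using pos by (intro member_le_sum) auto
    then show ?thesis by (simp add: C_def)
  qed
  then show ?thesis using q unfolding q_def[symmetric] by (intro exI[of _ C]) (simp add: field_simps)
qed

text \<open>If \<open>F n\<close> has diameter less than \<open>s n\<close> and \<open>sample_index j \<le> n\<close>, then it is too small to contain the images of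
  two points at distance more than \<open>1 / 2 ^ j\<close>. There are at most \<open>sample_index (j + 1)\<close> indices \<open>n\<close>
  for which this \<open>j\<close> is the one to use, so all preimages together cover only a bounded length, and it suffices to
  start from an interval that is longer.\<close>

lemma undominated_set_of_small_dim:
  assumes s: "s \<in> SS" and \<alpha>: "0 \<le> \<alpha>" "\<alpha> < 1"
    and ev: "\<And>\<gamma>. \<alpha> < \<gamma> \<Longrightarrow> \<gamma> < 1 \<Longrightarrow> \<forall>\<^sub>F N in sequentially. s N \<le> real N powr (- 1 / \<gamma>)"
  shows "\<exists>E. \<not> dominated (dilations s) E \<and> hausdorff_dim E \<le> ereal \<alpha>"
proof -
  define a where "a j = s (sample_index j)" for j
  have a0: "0 \<le> a j" for j
    unfolding a_def using SS_pos[OF s sample_index_bounds(3)[of j]] by simp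
  have bound: "\<exists>C. \<forall>j. a j \<le> C * (2 powr (- 1 / \<gamma>)) ^ j" if \<gamma>: "\<alpha> < \<gamma>" "\<gamma> < 1" for \<gamma>
    unfolding a_def using \<alpha> \<gamma>
    by (intro geometric_bound_of_samples[OF s, of "(\<alpha> + \<gamma>) / 2"] ev) auto
  let ?S = "\<Sum>j. real (sample_index (Suc j)) / 2 ^ j"
  obtain L where L: "?S < real L" using reals_Archimedean2 by blast
  define E where "E = staircase a ` {0..<real L}"
  have "hausdorff_dim E \<le> ereal \<alpha>"
  proof (rule hausdorff_dim_leI[OF \<alpha>])
    fix \<beta> assume \<beta>: "\<alpha> < \<beta>" "\<beta> < 1"
    define \<gamma> where "\<gamma> = (\<alpha> + \<beta>) / 2"
    have \<gamma>: "\<alpha> < \<gamma>" "\<gamma> < \<beta>" "\<gamma> < 1" "0 < \<gamma>" using \<alpha> \<beta> by (auto simp: \<gamma>_def)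
    then obtain C where C: "\<And>j. a j \<le> C * (2 powr (- 1 / \<gamma>)) ^ j" using bound by blast
    show "hausdorff_measure \<beta> E = 0"
      unfolding E_def
    proof (rule staircase_hausdorff_measure_0[OF a0 C])
      show "(2::real) powr (- 1 / \<gamma>) < 1 / 2" using two_powr_less_half[of "1 / \<gamma>"] \<gamma> by simp
      show "((2::real) powr (- 1 / \<gamma>)) powr \<beta> < 1 / 2"
        using two_powr_less_half[of "\<beta> / \<gamma>"] \<gamma> by (simp add: powr_powr)
    qed (use \<alpha> \<beta> in auto)
  qed
  moreover have "\<not> dominated (dilations s) E"
  proof
    assume dom: "dominated (dilations s) E"
    obtain F :: "nat \<Rightarrow> real set" where F: "E \<subseteq> (\<Union>n\<in>{1..}. F n)"
        "\<And>n. 1 \<le> n \<Longrightarrow> bounded (F n) \<and> diameter (F n) < s n"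
      using dom self_in_dilations unfolding dominated_def by blast
    have sm: "summable (\<lambda>i. a i * 2 ^ i)"
    proof -
      define \<gamma> where "\<gamma> = (\<alpha> + 1) / 2"
      have \<gamma>: "\<alpha> < \<gamma>" "\<gamma> < 1" "0 < \<gamma>" using \<alpha> by (auto simp: \<gamma>_def)
      then obtain C where C: "\<And>j. a j \<le> C * (2 powr (- 1 / \<gamma>)) ^ j" using bound by blast
      have "(2::real) powr (- 1 / \<gamma>) < 1 / 2" using two_powr_less_half[of "1 / \<gamma>"] \<gamma> by simp
      then show ?thesis using summable_geometric_bound(1)[OF a0 C, of 0] by simp
    qed
    let ?B = "\<lambda>j. {sample_index j..<sample_index (Suc j)}"
    let ?A = "\<lambda>j n. {u \<in> {0..<real L}. staircase a u \<in> F n}"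
    have "ennreal (real L) \<le> (\<Sum>j. \<Sum>n\<in>?B j. ennreal (1 / 2 ^ j))"
    proof (rule length_le_sum_of_spreads[where A = ?A])
      show "{0..<real L} \<subseteq> (\<Union>j. \<Union>n\<in>?B j. ?A j n)"
      proof
        fix u assume u: "u \<in> {0..<real L}"
        then have "staircase a u \<in> (\<Union>n\<in>{1..}. F n)" using F(1) unfolding E_def by blast
        then obtain n where n: "1 \<le> n" "staircase a u \<in> F n" by auto
        \<comment> \<open>The block that contains \<open>n\<close>; the blocks start at \<open>sample_index 0 = 1\<close>.\<close>
        define j where "j = (LEAST j. n < sample_index (Suc j))"
        have "\<exists>j. n < sample_index (Suc j)"
        proof -
          have "\<forall>\<^sub>F j in sequentially. Suc n \<le> sample_index j"
            using filterlim_sample_index by (simp add: filterlim_at_top)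
          then obtain i where "\<And>j. i \<le> j \<Longrightarrow> Suc n \<le> sample_index j"
            by (auto simp: eventually_sequentially)
          from this[of "Suc i"] show ?thesis by (auto simp: Suc_le_eq)
        qed
        then have j: "n < sample_index (Suc j)" unfolding j_def by (rule LeastI_ex)
        have "sample_index j \<le> n"
        proof (cases j)
          case 0
          then show ?thesis using n by (simp add: sample_index_def)
        next
          case (Suc i)
          then show ?thesis
            using not_less_Least[of i "\<lambda>j. n < sample_index (Suc j)"] by (simp add: j_def)
        qed
        then show "u \<in> (\<Union>j. \<Union>n\<in>?B j. ?A j n)"
          using j n u by (intro UN_I[of j] UN_I[of n]) auto
      qed
      fix j n u v assume n: "n \<in> ?B j" and uv: "u \<in> ?A j n" "v \<in> ?A j n"
      have n1: "1 \<le> n" using n sample_index_bounds(3)[of j] by simp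
      show "\<bar>u - v\<bar> \<le> 1 / 2 ^ j"
      proof (rule ccontr)
        assume "\<not> ?thesis"
        then have "a j \<le> \<bar>staircase a u - staircase a v\<bar>"
          by (intro staircase_separates a0 sm) simp
        also have "\<dots> \<le> diameter (F n)"
          using diameter_bounded_bound[of "F n"] F(2)[OF n1] uv by (simp add: dist_real_def)
        also have "\<dots> < s n" using F(2)[OF n1] by simp
        also have "\<dots> \<le> a j" unfolding a_def
          using n sample_index_bounds(3)[of j] by (intro SS_antimono[OF s]) auto
        finally show False by simp
      qed
    qed simp
    also have "\<dots> \<le> (\<Sum>j. ennreal (real (sample_index (Suc j)) / 2 ^ j))"
    proof (rule suminf_le)
      fix j
      have "(\<Sum>n\<in>?B j. ennreal (1 / 2 ^ j)) = ennreal (\<Sum>n\<in>?B j. 1 / 2 ^ j)"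
        by (rule sum_ennreal) simp
      also have "\<dots> \<le> ennreal (real (sample_index (Suc j)) / 2 ^ j)"
        by (intro ennreal_leI) (simp add: divide_right_mono)
      finally show "(\<Sum>n\<in>?B j. ennreal (1 / 2 ^ j)) \<le> ennreal (real (sample_index (Suc j)) / 2 ^ j)" .
    qed auto
    also have "\<dots> = ennreal ?S" by (intro suminf_ennreal2 summable_sample_index) simp
    finally have "real L \<le> ?S"
      by (subst (asm) ennreal_le_iff) (auto intro: suminf_nonneg[OF summable_sample_index])
    then show False using L by simp
  qed
  ultimately show ?thesis by blast
qed

section \<open>Dimension classes are not domination classes\<close>

theorem theorem7p4:
  "(\<forall>s\<in>SS. \<forall>\<alpha>::real. 0 \<le> \<alpha> \<and> \<alpha> < 1 \<longrightarrow> HD \<alpha> \<noteq> dominated_sets (dilations s)) \<and>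
   (\<forall>s\<in>SS. HD 1 \<noteq> dominated_sets (dilations s) \<longleftrightarrow> summable (\<lambda>n. s (Suc n)))"
proof (intro conjI ballI allI impI)
  fix s :: "nat \<Rightarrow> real" and \<alpha> :: real
  assume s: "s \<in> SS" and \<alpha>: "0 \<le> \<alpha> \<and> \<alpha> < 1"
  show "HD \<alpha> \<noteq> dominated_sets (dilations s)"
  proof (cases "\<exists>\<gamma>. \<alpha> < \<gamma> \<and> \<gamma> < 1 \<and> (\<exists>\<^sub>F N in sequentially. real N powr (- 1 / \<gamma>) < s N)")
    case True
    then obtain E where "dominated (dilations s) E" "ereal \<alpha> < hausdorff_dim E"
      using dominated_set_of_larger_dim[OF s] \<alpha> by blast
    then have "E \<notin> HD \<alpha>" "E \<in> dominated_sets (dilations s)"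
      by (simp_all add: HD_def dominated_sets_def)
    then show ?thesis by blast
  next
    case False
    have "\<forall>\<^sub>F N in sequentially. s N \<le> real N powr (- 1 / \<gamma>)" if "\<alpha> < \<gamma>" "\<gamma> < 1" for \<gamma>
    proof -
      have "\<not> (\<exists>\<^sub>F N in sequentially. real N powr (- 1 / \<gamma>) < s N)" using False that by blast
      then show ?thesis by (simp only: not_frequently not_less)
    qed
    then obtain E where "\<not> dominated (dilations s) E" "hausdorff_dim E \<le> ereal \<alpha>"
      using undominated_set_of_small_dim[OF s] \<alpha> by blast
    then have "E \<in> HD \<alpha>" "E \<notin> dominated_sets (dilations s)"
      by (simp_all add: HD_def dominated_sets_def)
    then show ?thesis by blast
  qed
next
  fix s :: "nat \<Rightarrow> real"
  assume s: "s \<in> SS"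
  have "HD 1 = UNIV" using hausdorff_dim_real_le_1 by (auto simp: HD_def)
  moreover have "dominated (dilations s) E" if "dominated (dilations s) UNIV" for E
    using that dominated_subset by blast
  then have "dominated_sets (dilations s) = UNIV \<longleftrightarrow> dominated (dilations s) UNIV"
    by (auto simp: dominated_sets_def)
  ultimately show "HD 1 \<noteq> dominated_sets (dilations s) \<longleftrightarrow> summable (\<lambda>n. s (Suc n))"
    using dominated_UNIV_iff[OF s] by auto
qed

end
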